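(* Let $\delta>0$ and $\beta\in\mathbb R$, and let $\rho_\beta$ be the thermal state at inverse temperature $\beta$ of a qubit with Hamiltonian $\delta\sigma_z/2$. For a binary measurement scheme $\mathscr M$ on the qubit, let $\mathcal F_\beta(\rho_\beta,\mathscr M)$ be its Fisher information, $\mathfrak D^{(\Delta)}_\beta(\mathscr M)$ its $\Delta$-disturbance, and $\mathcal F^{(Q)}_\beta=\mathcal F^{(Q)}_\beta(\rho_\beta)$ the quantum Fisher information of $\rho_\beta$. Then the trade-off region $$\big\{\big(\mathcal F_\beta(\rho_\beta,\mathscr M),\,\mathfrak D^{(\Delta)}_\beta(\mathscr M)\big):\ \mathscr M \text{ a binary measurement scheme}\big\}\subset\mathbb R^2$$ is the (closed, filled) triangle with vertices $(0,0)$, $(0,\mathcal F^{(Q)}_\beta)$ and $(\mathcal F^{(Q)}_\beta,\mathcal F^{(Q)}_\beta)$. Moreover, for each fixed value $\chi\in[0,1]$ of the non-commutativity, the set of points $\big(\mathcal F_\beta(\rho_\beta,\mathscr M),\mathfrak D^{(\Delta)}_\beta(\mathscr M)\big)$ obtained from all binary measurement schemes $\mathscr M$ with non-commutativity $\chi$ is the line segment with endpoints $(0,0)$ and $(\kappa(\chi)\,\mathcal F^{(Q)}_\beta,\ \mathcal F^{(Q)}_\beta)$, where $$\kappa(\chi)=\frac{2(1-\chi^2)}{2-\chi^2+\chi^2\cosh(\beta\delta)} .$$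
   Context: Thermal model: $\rho_\beta=\frac{1}{2\cosh(\beta\delta/2)}\,\mathrm{diag}(e^{-\beta\delta/2},e^{\beta\delta/2})$, regarded as a one-parameter family in $\beta$ with $\delta$ fixed. Binary measurement schemes: $\mathscr M$ is given by a POVM $\{\Pi_0,\Pi_1\}$ with $\Pi_1=\mathbb I_2-\Pi_0$ and $\Pi_0=w\mathbb I_2+x\sigma_x+y\sigma_y+z\sigma_z$, where $\sigma_x,\sigma_y,\sigma_z$ are the Pauli matrices, and in conical coordinates $(w,\lambda,\theta,\varphi)$ $$x=\lambda w\sin\theta\cos\varphi,\quad y=\lambda w\sin\theta\sin\varphi,\quad z=\lambda w\cos\theta,$$ with $0<w\le 1/2$, $0\le\lambda\le1$, $0\le\theta\le\pi$, $0\le\varphi\le2\pi$. (Up to relabelling outcomes this covers all two-outcome qubit POVMs with non-zero elements.) The non-commutativity of the measurement is $\chi=\sin\theta$; a measurement with $\lambda=0$ (uninformative, $\Pi_0=w\mathbb I_2$) is represented by every value of $\theta$ and so counts as having every value of $\chi$. Post-measurement states: measurements are implemented by the Lüders instrument; outcome $i$ has probability $p_{i,\beta}=\mathrm{tr}(\rho_\beta\Pi_i)$, and the conditional state is $\rho_{\beta|i}=\sqrt{\Pi_i}\,\rho_\beta\sqrt{\Pi_i}/p_{i,\beta}$. Fisher information: $\mathcal F_\beta(\rho_\beta,\mathscr M)=\sum_i p_{i,\beta}\,(\partial_\beta\log p_{i,\beta})^2$. Quantum Fisher information: for a differentiable family of density matrices $\rho_\beta$, $\mathcal F^{(Q)}_\beta(\rho_\beta)=\mathrm{tr}(\rho_\beta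 L^2)$, where the symmetric logarithmic derivative $L$ is a Hermitian matrix with $\partial_\beta\rho_\beta=\tfrac12(\rho_\beta L+L\rho_\beta)$. $\Delta$-disturbance (average information loss): $\mathfrak D^{(\Delta)}_\beta(\mathscr M)=\mathcal F^{(Q)}_\beta(\rho_\beta)-\sum_i p_{i,\beta}\,\mathcal F^{(Q)}_\beta(\rho_{\beta|i})$, where $\mathcal F^{(Q)}_\beta(\rho_{\beta|i})$ is the quantum Fisher information of the family $\beta\mapsto\rho_{\beta|i}$. *)

theory Defs
  imports "HOL-Analysis.Analysis"
begin

definition conj_transpose :: "complex^'n^'m \<Rightarrow> complex^'m^'n" where
  "conj_transpose A = (\<chi> i j. cnj (A $ j $ i))"

definition hermitian :: "complex^'n^'n \<Rightarrow> bool" where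
  "hermitian A \<longleftrightarrow> conj_transpose A = A"

definition pos_semidef :: "complex^'n^'n \<Rightarrow> bool" where
  "pos_semidef A \<longleftrightarrow> hermitian A \<and> (\<forall>v. 0 \<le> Re (\<Sum>i\<in>UNIV. cnj (v $ i) * (A *v v) $ i))"

definition psd_sqrt :: "complex^'n^'n \<Rightarrow> complex^'n^'n" where
  "psd_sqrt A = (THE S. pos_semidef S \<and> S ** S = A)"


definition is_symm_log_deriv :: "(real \<Rightarrow> complex^'n^'n) \<Rightarrow> real \<Rightarrow> complex^'n^'n \<Rightarrow> bool" where
  "is_symm_log_deriv \<rho> \<beta> L \<longleftrightarrow> hermitian L \<and>
     (\<rho> has_vector_derivative (1/2) *\<^sub>R (\<rho> \<beta> ** L + L ** \<rho> \<beta>)) (at \<beta>)"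

(* For a singular density matrix L is not unique, but tr(rho L^2) does not depend on its choice. *)
definition quantum_fisher_info :: "(real \<Rightarrow> complex^'n^'n) \<Rightarrow> real \<Rightarrow> real" where
  "quantum_fisher_info \<rho> \<beta> = (THE q. \<exists>L. is_symm_log_deriv \<rho> \<beta> L \<and> complex_of_real q = trace (\<rho> \<beta> ** (L ** L)))"


(* A two-outcome measurement is a function M :: nat => _, of which only M 0 and M 1 are used. *)

definition outcome_prob :: "(real \<Rightarrow> complex^'n^'n) \<Rightarrow> (nat \<Rightarrow> complex^'n^'n) \<Rightarrow> nat \<Rightarrow> real \<Rightarrow> real" where
  "outcome_prob \<rho> M i \<beta> = Re (trace (\<rho> \<beta> ** M i))"

definition post_state ::
  "(real \<Rightarrow> complex^'n^'n) \<Rightarrow> (nat \<Rightarrow> complex^'n^'n) \<Rightarrow> nat \<Rightarrow> real \<Rightarrow> complex^'n^'n" where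
  "post_state \<rho> M i \<beta> =
     (1 / outcome_prob \<rho> M i \<beta>) *\<^sub>R (psd_sqrt (M i) ** \<rho> \<beta> ** psd_sqrt (M i))"

definition fisher_info :: "(real \<Rightarrow> complex^'n^'n) \<Rightarrow> (nat \<Rightarrow> complex^'n^'n) \<Rightarrow> real \<Rightarrow> real" where
  "fisher_info \<rho> M \<beta> =
     (\<Sum>i\<in>{0,1}. outcome_prob \<rho> M i \<beta> * (deriv (\<lambda>b. ln (outcome_prob \<rho> M i b)) \<beta>)\<^sup>2)"

definition delta_disturbance ::
  "(real \<Rightarrow> complex^'n^'n) \<Rightarrow> (nat \<Rightarrow> complex^'n^'n) \<Rightarrow> real \<Rightarrow> real" where
  "delta_disturbance \<rho> M \<beta> =
     quantum_fisher_info \<rho> \<beta> - (\<Sum>i\<in>{0,1}. outcome_prob \<rho> M i \<beta> * quantum_fisher_info (post_state \<rho> M i) \<beta>)"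


definition sigma_x :: "complex^2^2" where
  "sigma_x = vector [vector [0, 1], vector [1, 0]]"

definition sigma_y :: "complex^2^2" where
  "sigma_y = vector [vector [0, - \<i>], vector [\<i>, 0]]"

definition sigma_z :: "complex^2^2" where
  "sigma_z = vector [vector [1, 0], vector [0, -1]]"

definition thermal_state :: "real \<Rightarrow> real \<Rightarrow> complex^2^2" where
  "thermal_state \<delta> \<beta> = (1 / (2 * cosh (\<beta> * \<delta> / 2))) *\<^sub>R
     vector [vector [complex_of_real (exp (- \<beta> * \<delta> / 2)), 0],
             vector [0, complex_of_real (exp (\<beta> * \<delta> / 2))]]"

definition conical_coords :: "real \<Rightarrow> real \<Rightarrow> real \<Rightarrow> real \<Rightarrow> bool" where
  "conical_coords w r \<theta> \<phi> \<longleftrightarrow>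
     0 < w \<and> w \<le> 1/2 \<and> 0 \<le> r \<and> r \<le> 1 \<and> 0 \<le> \<theta> \<and> \<theta> \<le> pi \<and> 0 \<le> \<phi> \<and> \<phi> \<le> 2 * pi"

definition conical_effect :: "real \<Rightarrow> real \<Rightarrow> real \<Rightarrow> real \<Rightarrow> complex^2^2" where
  "conical_effect w r \<theta> \<phi> =
     w *\<^sub>R mat 1 + (r * w * sin \<theta> * cos \<phi>) *\<^sub>R sigma_x
     + (r * w * sin \<theta> * sin \<phi>) *\<^sub>R sigma_y + (r * w * cos \<theta>) *\<^sub>R sigma_z"

definition binary_povm :: "complex^'n^'n \<Rightarrow> nat \<Rightarrow> complex^'n^'n" where
  "binary_povm P i = (if i = 0 then P else mat 1 - P)"

definition binary_scheme :: "(nat \<Rightarrow> complex^2^2) \<Rightarrow> bool" where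
  "binary_scheme M \<longleftrightarrow>
     (\<exists>w r \<theta> \<phi>. conical_coords w r \<theta> \<phi> \<and> M = binary_povm (conical_effect w r \<theta> \<phi>))"

(* A relation, not a function: the same M with r = 0 arises from every theta. *)
definition has_noncommutativity :: "(nat \<Rightarrow> complex^2^2) \<Rightarrow> real \<Rightarrow> bool" where
  "has_noncommutativity M c \<longleftrightarrow>
     (\<exists>w r \<theta> \<phi>. conical_coords w r \<theta> \<phi> \<and> M = binary_povm (conical_effect w r \<theta> \<phi>)
        \<and> c = sin \<theta>)"

definition kappa :: "real \<Rightarrow> real \<Rightarrow> real \<Rightarrow> real" where
  "kappa \<delta> \<beta> c = 2 * (1 - c\<^sup>2) / (2 - c\<^sup>2 + c\<^sup>2 * cosh (\<beta> * \<delta>))"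


lemma pauli_form_pos_semidef:
  fixes w x y z :: real
  assumes "0 \<le> w" and "x\<^sup>2 + y\<^sup>2 + z\<^sup>2 \<le> w\<^sup>2"
  shows "pos_semidef (w *\<^sub>R mat 1 + x *\<^sub>R sigma_x + y *\<^sub>R sigma_y + z *\<^sub>R sigma_z)"
    (is "pos_semidef ?A")
proof -
  have herm: "hermitian ?A"
    unfolding hermitian_def conj_transpose_def sigma_x_def sigma_y_def sigma_z_def
    by (simp add: vec_eq_iff forall_2 vector_2 mat_def complex_eq_iff)
  have "0 \<le> Re (\<Sum>i\<in>UNIV. cnj (v $ i) * (?A *v v) $ i)" for v
  proof -
    define a b c d where abcd: "a = Re (v $ 1)" "b = Im (v $ 1)" "c = Re (v $ 2)" "d = Im (v $ 2)"
    define N where "N = a\<^sup>2 + b\<^sup>2 + c\<^sup>2 + d\<^sup>2"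
    define s1 s2 s3 where s: "s1 = 2 * (a*c + b*d)" "s2 = 2 * (a*d - b*c)"
      "s3 = a\<^sup>2 + b\<^sup>2 - c\<^sup>2 - d\<^sup>2"
    define t where "t = x * s1 + y * s2 + z * s3"
    have eq: "Re (\<Sum>i\<in>UNIV. cnj (v $ i) * (?A *v v) $ i) = w * N + t"
      unfolding sigma_x_def sigma_y_def sigma_z_def matrix_vector_mult_def
      by (simp add: sum_2 vector_2 mat_def abcd N_def s t_def algebra_simps power2_eq_square)
    have N0: "0 \<le> N" by (simp add: N_def)
    have sN: "s1\<^sup>2 + s2\<^sup>2 + s3\<^sup>2 = N\<^sup>2"
      unfolding s N_def by (simp add: power2_eq_square algebra_simps)
    have "(x\<^sup>2 + y\<^sup>2 + z\<^sup>2) * (s1\<^sup>2 + s2\<^sup>2 + s3\<^sup>2) - t\<^sup>2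
        = (x * s2 - y * s1)\<^sup>2 + (x * s3 - z * s1)\<^sup>2 + (y * s3 - z * s2)\<^sup>2"
      unfolding t_def by (simp add: power2_eq_square algebra_simps)
    then have "t\<^sup>2 \<le> (x\<^sup>2 + y\<^sup>2 + z\<^sup>2) * N\<^sup>2"
      using sN by (smt (verit) zero_le_power2)
    also have "\<dots> \<le> w\<^sup>2 * N\<^sup>2"
      using assms(2) by (intro mult_right_mono) auto
    finally have "t\<^sup>2 \<le> (w * N)\<^sup>2" by (simp add: power_mult_distrib)
    then have "\<bar>t\<bar> \<le> w * N"
      using N0 assms(1) by (simp add: abs_le_square_iff[symmetric])
    then show ?thesis unfolding eq by linarith
  qed
  with herm show ?thesis by (simp add: pos_semidef_def)
qed

lemma binary_scheme_povm:
  assumes "binary_scheme M"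
  shows "pos_semidef (M 0)" and "pos_semidef (M 1)" and "M 0 + M 1 = mat 1"
proof -
  obtain w l \<theta> \<phi> where dom: "conical_coords w l \<theta> \<phi>"
    and M: "M = binary_povm (conical_effect w l \<theta> \<phi>)"
    using assms by (auto simp: binary_scheme_def)
  define x y z where xyz: "x = l * w * sin \<theta> * cos \<phi>" "y = l * w * sin \<theta> * sin \<phi>"
    "z = l * w * cos \<theta>"
  have w: "0 < w" "w \<le> 1/2" "0 \<le> l" "l \<le> 1" using dom by (auto simp: conical_coords_def)
  have "x\<^sup>2 + y\<^sup>2 + z\<^sup>2
      = (l * w)\<^sup>2 * ((sin \<theta>)\<^sup>2 * ((cos \<phi>)\<^sup>2 + (sin \<phi>)\<^sup>2) + (cos \<theta>)\<^sup>2)"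
    unfolding xyz by algebra
  then have n: "x\<^sup>2 + y\<^sup>2 + z\<^sup>2 = (l * w)\<^sup>2" by (simp only: sin_cos_squared_add2 sin_cos_squared_add mult_1_right)
  have "l * w \<le> w" using w by (simp add: mult_left_le_one_le)
  then have le: "(l * w)\<^sup>2 \<le> w\<^sup>2" using w by (intro power_mono) auto
  have le': "w\<^sup>2 \<le> (1 - w)\<^sup>2" using w by (intro power_mono) auto
  have M0: "M 0 = w *\<^sub>R mat 1 + x *\<^sub>R sigma_x + y *\<^sub>R sigma_y + z *\<^sub>R sigma_z"
    by (simp add: M binary_povm_def conical_effect_def xyz)
  have M1: "M 1 = (1 - w) *\<^sub>R mat 1 + (- x) *\<^sub>R sigma_x + (- y) *\<^sub>R sigma_y + (- z) *\<^sub>R sigma_z"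
    by (simp add: M binary_povm_def conical_effect_def xyz scaleR_diff_left)
  show "pos_semidef (M 0)"
    unfolding M0 using w n le by (intro pauli_form_pos_semidef) auto
  show "pos_semidef (M 1)"
    unfolding M1
  proof (rule pauli_form_pos_semidef)
    show "0 \<le> 1 - w" using w by simp
    show "(- x)\<^sup>2 + (- y)\<^sup>2 + (- z)\<^sup>2 \<le> (1 - w)\<^sup>2"
      using n le le' by (simp only: power2_minus)
  qed
  show "M 0 + M 1 = mat 1" by (simp add: M binary_povm_def)
qed

end

theory Submission
  imports Defs
begin

text \<open>Write \<open>t = tanh (\<beta> \<delta> / 2)\<close>, \<open>p\<^sub>i\<close> for the outcome probabilities, \<open>Q\<close> for the quantum Fisher
  information of \<open>\<rho>\<close>. The Lueders update by \<open>\<Pi>\<^sub>i\<close> acts on (trace, Bloch vector) as a scaled Lorentz boost, and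
  the quantum Fisher metric of a qubit is \<open>1 - |R|\<^sup>2\<close> times the boost-invariant Klein metric of the
  Bloch ball. Hence the conditional state has quantum Fisher information \<open>det \<Pi>\<^sub>i / p\<^sub>i\<^sup>2 \<cdot> Q\<close>, and the
  disturbance is \<open>g Q\<close> with
  \<open>g = 1 - det \<Pi>\<^sub>0 / p\<^sub>0 - det \<Pi>\<^sub>1 / p\<^sub>1 = (\<lambda> w)\<^sup>2 (1 - t\<^sup>2 cos\<^sup>2 \<theta>) / (p\<^sub>0 p\<^sub>1)\<close>, while the Fisher
  information is \<open>g \<kappa>(sin \<theta>) Q\<close>. For each \<open>\<theta>\<close> the factor \<open>g\<close> takes all values in \<open>[0, 1]\<close>, already
  with \<open>w = 1/2\<close>, and \<open>\<kappa>\<close> maps \<open>[0, 1]\<close> onto \<open>[0, 1]\<close>, so the segments sweep out the triangle.\<close>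

section \<open>Hermitian 2x2 matrices in Pauli coordinates\<close>

text \<open>Real coordinates on the Hermitian 2x2 matrices: matrix equations become polynomial
  equations between the four coordinates. The eigenvalues are \<open>w\<close> plus and minus the
  length of \<open>(x, y, z)\<close>.\<close>

definition pauli :: "real \<Rightarrow> real \<Rightarrow> real \<Rightarrow> real \<Rightarrow> complex^2^2" where
  "pauli w x y z = w *\<^sub>R mat 1 + x *\<^sub>R sigma_x + y *\<^sub>R sigma_y + z *\<^sub>R sigma_z"

lemma pauli_nth:
  "pauli w x y z $ 1 $ 1 = complex_of_real (w + z)"
  "pauli w x y z $ 1 $ 2 = Complex x (- y)"
  "pauli w x y z $ 2 $ 1 = Complex x y"
  "pauli w x y z $ 2 $ 2 = complex_of_real (w - z)"
  by (auto simp: pauli_def sigma_x_def sigma_y_def sigma_z_def mat_def complex_eq_iff)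

lemma matrix_mult_nth_2: "(A ** B) $ i $ j = A $ i $ 1 * B $ 1 $ j + A $ i $ 2 * B $ 2 $ j"
  for A B :: "complex^2^2"
  by (simp add: matrix_matrix_mult_def sum_2)

lemma pauli_eq_iff:
  "pauli w x y z = pauli w' x' y' z' \<longleftrightarrow> w = w' \<and> x = x' \<and> y = y' \<and> z = z'"
  by (auto simp: vec_eq_iff forall_2 pauli_nth complex_eq_iff)

lemma scaleR_pauli: "c *\<^sub>R pauli w x y z = pauli (c * w) (c * x) (c * y) (c * z)"
  by (simp add: pauli_def scaleR_add_right)

lemma hermitian_pauli: "hermitian (pauli w x y z)"
  by (simp add: hermitian_def conj_transpose_def vec_eq_iff forall_2 pauli_nth complex_eq_iff)

lemma hermitian_eq_pauli:
  assumes "hermitian (A :: complex^2^2)"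
  obtains w x y z where "A = pauli w x y z"
proof -
  have h: "cnj (A $ j $ i) = A $ i $ j" for i j
    using assms by (simp add: hermitian_def conj_transpose_def vec_eq_iff)
  have i: "Im (A $ 1 $ 1) = 0" "Im (A $ 2 $ 2) = 0"
    "Re (A $ 1 $ 2) = Re (A $ 2 $ 1)" "Im (A $ 1 $ 2) = - Im (A $ 2 $ 1)"
    using h[of 1 1] h[of 2 2] h[of 1 2] by (auto simp: complex_eq_iff)
  have "A = pauli ((Re (A $ 1 $ 1) + Re (A $ 2 $ 2)) / 2) (Re (A $ 2 $ 1)) (Im (A $ 2 $ 1))
               ((Re (A $ 1 $ 1) - Re (A $ 2 $ 2)) / 2)"
    using i by (simp add: vec_eq_iff forall_2 pauli_nth complex_eq_iff field_simps)
  then show ?thesis by (rule that)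
qed

lemma pauli_square:
  "pauli w x y z ** pauli w x y z
     = pauli (w\<^sup>2 + x\<^sup>2 + y\<^sup>2 + z\<^sup>2) (2 * w * x) (2 * w * y) (2 * w * z)"
  by (simp add: vec_eq_iff forall_2 pauli_nth matrix_mult_nth_2 complex_eq_iff power2_eq_square
      algebra_simps)

lemma pauli_symm_product:
  "pauli w x y z ** pauli w' x' y' z' + pauli w' x' y' z' ** pauli w x y z
     = pauli (2 * (w * w' + x * x' + y * y' + z * z'))
         (2 * (w * x' + w' * x)) (2 * (w * y' + w' * y)) (2 * (w * z' + w' * z))"
  by (simp add: vec_eq_iff forall_2 pauli_nth matrix_mult_nth_2 complex_eq_iff algebra_simps)

lemma trace_pauli_mult:
  "trace (pauli w x y z ** pauli w' x' y' z')
     = complex_of_real (2 * (w * w' + x * x' + y * y' + z * z'))"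
  by (simp add: trace_def sum_2 pauli_nth matrix_mult_nth_2 complex_eq_iff algebra_simps)

text \<open>The unnormalised Lueders update of a diagonal state, with the outer factor in the role
  of the square root of an effect.\<close>

lemma pauli_sandwich:
  "pauli a b c d ** pauli v 0 0 r ** pauli a b c d
     = pauli (v * (a\<^sup>2 + b\<^sup>2 + c\<^sup>2 + d\<^sup>2) + 2 * a * d * r)
         (2 * a * v * b + 2 * d * r * b) (2 * a * v * c + 2 * d * r * c)
         (2 * a * v * d + (a\<^sup>2 - b\<^sup>2 - c\<^sup>2 - d\<^sup>2) * r + 2 * d * r * d)"
  by (simp add: vec_eq_iff forall_2 pauli_nth matrix_mult_nth_2 complex_eq_iff power2_eq_square
      algebra_simps)

section \<open>Positivity and square roots in Pauli coordinates\<close>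

text \<open>Converse of \<open>pauli_form_pos_semidef\<close>: the quadratic form is tested on an
  eigenvector for the smaller eigenvalue \<open>w - n\<close>.\<close>

lemma pos_semidef_pauliD:
  assumes "pos_semidef (pauli w x y z)"
  shows "0 \<le> w" "x\<^sup>2 + y\<^sup>2 + z\<^sup>2 \<le> w\<^sup>2"
proof -
  define n where "n = sqrt (x\<^sup>2 + y\<^sup>2 + z\<^sup>2)"
  have n2: "n\<^sup>2 = x\<^sup>2 + y\<^sup>2 + z\<^sup>2" and n0: "0 \<le> n" by (simp_all add: n_def)
  have q: "0 \<le> Re (\<Sum>i\<in>UNIV. cnj (v $ i) * (pauli w x y z *v v) $ i)" for v
    using assms by (simp add: pos_semidef_def)
  have "n \<le> w"
  proof (cases "n = z")
    \<comment> \<open>The eigenvector of the other case is zero here, so the second basis vector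
      replaces it; its value is \<open>w - z\<close>.\<close>
    case True
    then have "x = 0" "y = 0" using n2 by (auto simp: sum_power2_eq_zero_iff)
    then show ?thesis using q[of "vector [0, 1]"] True
      by (simp add: matrix_vector_mult_def sum_2 pauli_nth vector_2)
  next
    case False
    have "z\<^sup>2 \<le> n\<^sup>2" using n2 by simp
    then have zn: "z < n" using n0 False by (metis abs_le_square_iff abs_of_nonneg abs_le_D1 less_le)
    \<comment> \<open>an eigenvector of the traceless part for the eigenvalue \<open>- n\<close>\<close>
    define v :: "complex^2" where "v = vector [complex_of_real (z - n), Complex x y]"
    have "Re (\<Sum>i\<in>UNIV. cnj (v $ i) * (pauli w x y z *v v) $ i)
        = (w + z) * (z - n)\<^sup>2 + 2 * (z - n) * (x\<^sup>2 + y\<^sup>2) + (w - z) * (x\<^sup>2 + y\<^sup>2)"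
      by (simp add: matrix_vector_mult_def sum_2 pauli_nth v_def vector_2 power2_eq_square
          algebra_simps)
    also have "x\<^sup>2 + y\<^sup>2 = (n - z) * (n + z)" using n2 by (simp add: power2_eq_square algebra_simps)
    \<comment> \<open>The value is \<open>w - n\<close> times the squared norm
      \<open>2 * n * (n - z)\<close> of \<open>v\<close>.\<close>
    finally have "0 \<le> (n - z) * ((w - n) * (2 * n))"
      using q[of v] by (simp add: power2_eq_square algebra_simps)
    then have "0 \<le> (w - n) * (2 * n)" using zn by (simp add: zero_le_mult_iff)
    moreover have "n \<noteq> 0" using zn n2 by (auto simp: add_nonneg_eq_0_iff)
    ultimately show ?thesis using n0 by (simp add: zero_le_mult_iff)
  qed
  then show "0 \<le> w" "x\<^sup>2 + y\<^sup>2 + z\<^sup>2 \<le> w\<^sup>2"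
    using n0 by (auto simp flip: n2 intro: power_mono)
qed

text \<open>A positive root has as determinant the nonnegative root of the determinant of the
  matrix. This fixes its half trace \<open>a\<close>, and since \<open>0 < w\<close> makes
  \<open>a\<close> positive, the other coordinates follow by division.\<close>

lemma psd_sqrt_pauli:
  assumes w: "0 < w" and le: "x\<^sup>2 + y\<^sup>2 + z\<^sup>2 \<le> w\<^sup>2"
  obtains a b c d where "psd_sqrt (pauli w x y z) = pauli a b c d"
    "w = a\<^sup>2 + b\<^sup>2 + c\<^sup>2 + d\<^sup>2" "x = 2 * a * b" "y = 2 * a * c" "z = 2 * a * d"
proof -
  \<comment> \<open>\<open>D\<close> is the root of the determinant; the half trace of the root of a
    matrix with eigenvalues \<open>w + n\<close> and \<open>w - n\<close> has square
    \<open>(w + D) / 2\<close>.\<close>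
  define D where "D = sqrt (w\<^sup>2 - (x\<^sup>2 + y\<^sup>2 + z\<^sup>2))"
  define a where "a = sqrt ((w + D) / 2)"
  have D0: "0 \<le> D" and D2: "D\<^sup>2 = w\<^sup>2 - (x\<^sup>2 + y\<^sup>2 + z\<^sup>2)" using le by (simp_all add: D_def)
  have a0: "0 < a" and a2: "a\<^sup>2 = (w + D) / 2" using w D0 by (simp_all add: a_def)
  define b c d where bcd: "b = x / (2 * a)" "c = y / (2 * a)" "d = z / (2 * a)"
  have xyz: "x = 2 * a * b" "y = 2 * a * c" "z = 2 * a * d" using a0 by (simp_all add: bcd)
  have a2': "2 * a\<^sup>2 = w + D" using a2 by simp
  have "(w + D) * (2 * (b\<^sup>2 + c\<^sup>2 + d\<^sup>2)) = x\<^sup>2 + y\<^sup>2 + z\<^sup>2"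
    using a2' unfolding xyz by algebra
  also have "\<dots> = (w + D) * (w - D)" using D2 by (simp add: power2_eq_square algebra_simps)
  finally have "(w + D) * (2 * (b\<^sup>2 + c\<^sup>2 + d\<^sup>2)) = (w + D) * (w - D)" .
  then have n: "2 * (b\<^sup>2 + c\<^sup>2 + d\<^sup>2) = w - D"
    using w D0 by (metis add_pos_nonneg less_irrefl mult_left_cancel)
  have weq: "w = a\<^sup>2 + b\<^sup>2 + c\<^sup>2 + d\<^sup>2" using n a2 by simp
  have "psd_sqrt (pauli w x y z) = pauli a b c d"
    unfolding psd_sqrt_def
  proof (rule the_equality)
    have "b\<^sup>2 + c\<^sup>2 + d\<^sup>2 \<le> a\<^sup>2" using n a2 D0 by (simp add: field_simps)
    then show "pos_semidef (pauli a b c d) \<and> pauli a b c d ** pauli a b c d = pauli w x y z"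
      using a0 weq xyz pauli_form_pos_semidef[of a b c d] by (simp add: pauli_square flip: pauli_def)
  next
    fix S assume S: "pos_semidef S \<and> S ** S = pauli w x y z"
    then obtain a' b' c' d' where S': "S = pauli a' b' c' d'"
      by (auto simp: pos_semidef_def elim: hermitian_eq_pauli)
    have eq: "w = a'\<^sup>2 + b'\<^sup>2 + c'\<^sup>2 + d'\<^sup>2" "x = 2 * a' * b'" "y = 2 * a' * c'" "z = 2 * a' * d'"
      and p: "0 \<le> a'" "b'\<^sup>2 + c'\<^sup>2 + d'\<^sup>2 \<le> a'\<^sup>2"
      using S pos_semidef_pauliD[of a' b' c' d'] by (auto simp: S' pauli_square pauli_eq_iff)
    \<comment> \<open>The right side is the squared determinant of \<open>S\<close>; positivity of
      \<open>S\<close> then settles the sign.\<close>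
    have "D\<^sup>2 = (a'\<^sup>2 - (b'\<^sup>2 + c'\<^sup>2 + d'\<^sup>2))\<^sup>2" unfolding D2 eq by algebra
    then have "D = a'\<^sup>2 - (b'\<^sup>2 + c'\<^sup>2 + d'\<^sup>2)" using D0 p by (simp add: power2_eq_iff_nonneg)
    then have "a'\<^sup>2 = a\<^sup>2" using a2 eq by simp
    then have "a' = a" using a0 p by (simp add: power2_eq_iff_nonneg)
    then show "S = pauli a b c d" using eq xyz a0 by (simp add: S')
  qed
  with weq xyz show ?thesis using that by blast
qed

section \<open>Quantum Fisher information\<close>

text \<open>For two symmetric logarithmic derivatives \<open>L\<close>, \<open>K\<close> of the same family, both values equal the
  trace of the derivative of \<open>\<rho>\<close> times the other one, an expression symmetric in \<open>L\<close> and \<open>K\<close>.\<close>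

lemma trace_symm_log_deriv_unique:
  fixes R L K :: "complex^'n^'n"
  assumes "R ** L + L ** R = R ** K + K ** R"
  shows "trace (R ** (L ** L)) = trace (R ** (K ** K))"
proof -
  have cyc: "trace (A ** R ** B) = trace (R ** (B ** A))" for A B :: "complex^'n^'n"
    by (metis matrix_mul_assoc trace_mul_sym)
  have sym: "trace ((R ** A + A ** R) ** B) = trace (R ** (A ** B)) + trace (R ** (B ** A))"
    for A B :: "complex^'n^'n"
    using trace_mul_sym[of "R ** A + A ** R" B] cyc[of B A] trace_mul_sym[of "B ** A" R]
    by (simp add: matrix_add_ldistrib trace_add matrix_mul_assoc)
  have "trace (R ** (L ** L)) + trace (R ** (L ** L)) = trace ((R ** K + K ** R) ** L)"
    using sym[of L L] assms by simp
  also have "\<dots> = trace ((R ** L + L ** R) ** K)"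
    unfolding sym by (rule add.commute)
  also have "\<dots> = trace (R ** (K ** K)) + trace (R ** (K ** K))"
    unfolding assms sym ..
  finally show ?thesis by simp
qed

text \<open>One symmetric logarithmic derivative suffices to evaluate the definite description: any
  other one represents the same derivative of the family, so
  \<open>trace_symm_log_deriv_unique\<close> applies.\<close>

lemma quantum_fisher_info_eqI:
  assumes L: "is_symm_log_deriv \<rho> \<beta> L" and q: "complex_of_real q = trace (\<rho> \<beta> ** (L ** L))"
  shows "quantum_fisher_info \<rho> \<beta> = q"
  unfolding quantum_fisher_info_def
proof (rule the_equality)
  show "\<exists>L. is_symm_log_deriv \<rho> \<beta> L \<and> complex_of_real q = trace (\<rho> \<beta> ** (L ** L))"
    using assms by blast
next
  fix q' assume "\<exists>L. is_symm_log_deriv \<rho> \<beta> L \<and> complex_of_real q' = trace (\<rho> \<beta> ** (L ** L))"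
  then obtain K where K: "is_symm_log_deriv \<rho> \<beta> K"
    and q': "complex_of_real q' = trace (\<rho> \<beta> ** (K ** K))" by blast
  have "(1/2::real) *\<^sub>R (\<rho> \<beta> ** L + L ** \<rho> \<beta>) = (1/2::real) *\<^sub>R (\<rho> \<beta> ** K + K ** \<rho> \<beta>)"
    using L K unfolding is_symm_log_deriv_def by (blast intro: vector_derivative_unique_at)
  then have "trace (\<rho> \<beta> ** (L ** L)) = trace (\<rho> \<beta> ** (K ** K))"
    by (intro trace_symm_log_deriv_unique) simp
  then show "q' = q" using q q' by (metis of_real_eq_iff)
qed

lemma has_vector_derivative_pauli:
  assumes "(w has_real_derivative w') (at t)" "(x has_real_derivative x') (at t)"
    "(y has_real_derivative y') (at t)" "(z has_real_derivative z') (at t)"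
  shows "((\<lambda>s. pauli (w s) (x s) (y s) (z s)) has_vector_derivative pauli w' x' y' z') (at t)"
proof -
  have "((\<lambda>s. f s *\<^sub>R (A :: complex^2^2)) has_vector_derivative f' *\<^sub>R A) (at t)"
    if "(f has_real_derivative f') (at t)" for f f' A
    using has_vector_derivative_scaleR[OF that has_vector_derivative_const[of A]] by simp
  then show ?thesis unfolding pauli_def using assms by (intro has_vector_derivative_add) auto
qed

text \<open>Stating the usual coefficient \<open>k = r \<bullet> r' / (1 - r \<bullet> r)\<close> multiplicatively covers pure
  states as well.\<close>

lemma quantum_fisher_info_bloch:
  assumes deriv: "(x has_real_derivative x') (at \<beta>)" "(y has_real_derivative y') (at \<beta>)"
      "(z has_real_derivative z') (at \<beta>)"
    and k: "k * (1 - ((x \<beta>)\<^sup>2 + (y \<beta>)\<^sup>2 + (z \<beta>)\<^sup>2)) = x \<beta> * x' + y \<beta> * y' + z \<beta> * z'"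
  shows "quantum_fisher_info (\<lambda>b. pauli (1/2) (x b / 2) (y b / 2) (z b / 2)) \<beta>
    = x'\<^sup>2 + y'\<^sup>2 + z'\<^sup>2 + k * (x \<beta> * x' + y \<beta> * y' + z \<beta> * z')"
proof (rule quantum_fisher_info_eqI)
  let ?\<rho> = "\<lambda>b. pauli (1/2) (x b / 2) (y b / 2) (z b / 2)"
  \<comment> \<open>In the anticommutator with \<open>?\<rho> \<beta>\<close> the multiples of the
    Bloch vector cancel, and the identity component vanishes exactly by the assumption on
    \<open>k\<close>.\<close>
  let ?L = "pauli (- k) (x' + k * x \<beta>) (y' + k * y \<beta>) (z' + k * z \<beta>)"
  have d: "(?\<rho> has_vector_derivative pauli 0 (x' / 2) (y' / 2) (z' / 2)) (at \<beta>)"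
    using deriv by (intro has_vector_derivative_pauli DERIV_const DERIV_cdivide)
  have e: "(1/2) *\<^sub>R (?\<rho> \<beta> ** ?L + ?L ** ?\<rho> \<beta>) = pauli 0 (x' / 2) (y' / 2) (z' / 2)"
    unfolding pauli_symm_product scaleR_pauli pauli_eq_iff using k
    by (simp add: power2_eq_square field_simps)
  show "is_symm_log_deriv ?\<rho> \<beta> ?L"
    using d by (simp add: is_symm_log_deriv_def hermitian_pauli e)
  show "complex_of_real (x'\<^sup>2 + y'\<^sup>2 + z'\<^sup>2 + k * (x \<beta> * x' + y \<beta> * y' + z \<beta> * z'))
      = trace (?\<rho> \<beta> ** (?L ** ?L))"
    unfolding pauli_square trace_pauli_mult of_real_eq_iff using k by algebra
qed

lemma quantum_fisher_info_diag:
  assumes t: "(t has_real_derivative t') (at \<beta>)" and lt: "(t \<beta>)\<^sup>2 < 1"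
  shows "quantum_fisher_info (\<lambda>b. pauli (1/2) 0 0 (- t b / 2)) \<beta> = t'\<^sup>2 / (1 - (t \<beta>)\<^sup>2)"
proof -
  let ?k = "t \<beta> * t' / (1 - (t \<beta>)\<^sup>2)"
  have "quantum_fisher_info (\<lambda>b. pauli (1/2) (0 / 2) (0 / 2) ((- t b) / 2)) \<beta>
      = 0\<^sup>2 + 0\<^sup>2 + (- t')\<^sup>2 + ?k * (0 * 0 + 0 * 0 + (- t \<beta>) * (- t'))"
    by (rule quantum_fisher_info_bloch) (use lt in \<open>auto intro: DERIV_minus t\<close>)
  also have "\<dots> = t'\<^sup>2 / (1 - (t \<beta>)\<^sup>2)" using lt by (simp add: field_simps power2_eq_square)
  finally show ?thesis by simp
qed

section \<open>Measuring a diagonal qubit family\<close>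

lemma outcome_prob_diag:
  assumes "M i = pauli w x y z"
  shows "outcome_prob (\<lambda>b. pauli (1/2) 0 0 (- t b / 2)) M i b = w - t b * z"
  by (simp add: outcome_prob_def assms trace_pauli_mult)

text \<open>As \<open>t\<close> varies, the conditional Bloch vector stays on a chord of the ball.
  All scalar products needed in \<open>quantum_fisher_info_bloch\<close> reduce to \<open>w\<close>,
  \<open>z\<close>, \<open>t \<beta>\<close> and the determinant of the effect; the last factor is
  the value in \<open>quantum_fisher_info_diag\<close>.\<close>

lemma quantum_fisher_info_post_state:
  assumes t: "(t has_real_derivative t') (at \<beta>)" and lt: "\<And>b. \<bar>t b\<bar> < 1"
    and w: "0 < w" and le: "x\<^sup>2 + y\<^sup>2 + z\<^sup>2 \<le> w\<^sup>2" and M: "M i = pauli w x y z"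
  shows "quantum_fisher_info (post_state (\<lambda>b. pauli (1/2) 0 0 (- t b / 2)) M i) \<beta>
    = (w\<^sup>2 - (x\<^sup>2 + y\<^sup>2 + z\<^sup>2)) / (w - t \<beta> * z)\<^sup>2 * (t'\<^sup>2 / (1 - (t \<beta>)\<^sup>2))"
proof -
  obtain a b c d where S: "psd_sqrt (pauli w x y z) = pauli a b c d"
    and weq: "w = a\<^sup>2 + b\<^sup>2 + c\<^sup>2 + d\<^sup>2" and xyz: "x = 2 * a * b" "y = 2 * a * c" "z = 2 * a * d"
    using psd_sqrt_pauli[OF w le] by metis
  \<comment> \<open>The determinant of the root, hence \<open>D2\<close>: its square is the
    determinant of the effect.\<close>
  define D where "D = a\<^sup>2 - b\<^sup>2 - c\<^sup>2 - d\<^sup>2"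
  have D2: "D\<^sup>2 = w\<^sup>2 - (x\<^sup>2 + y\<^sup>2 + z\<^sup>2)" unfolding D_def weq xyz by algebra
  have "z\<^sup>2 \<le> w\<^sup>2" using le by (smt (verit) zero_le_power2)
  then have zw: "\<bar>z\<bar> \<le> w" using w by (simp flip: abs_le_square_iff)
  have p: "0 < w - t s * z" for s
  proof -
    have "\<bar>t s * z\<bar> \<le> \<bar>t s\<bar> * w" using zw by (simp add: abs_mult mult_left_mono)
    also have "\<dots> < w" using lt[of s] w by simp
    finally show ?thesis by linarith
  qed
  \<comment> \<open>Sandwiching with the root sends the identity to \<open>(w, x, y, z)\<close> and
    \<open>- sigma_z\<close> to \<open>(- z, B1, B2, B3)\<close>. It scales the Minkowski form by
    the square of \<open>D\<close>; this is the content of \<open>D2\<close>, \<open>AB\<close> and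
    \<open>BB\<close> below.\<close>
  define B1 B2 B3 where B: "B1 = - 2 * d * b" "B2 = - 2 * d * c" "B3 = - D - 2 * d\<^sup>2"
  have post: "post_state (\<lambda>b. pauli (1/2) 0 0 (- t b / 2)) M i
      = (\<lambda>s. pauli (1/2) ((x + t s * B1) / (w - t s * z) / 2) ((y + t s * B2) / (w - t s * z) / 2)
              ((z + t s * B3) / (w - t s * z) / 2))"
  proof
    fix s
    have "1 / (w - t s * z) * (1 / 2 * (a\<^sup>2 + b\<^sup>2 + c\<^sup>2 + d\<^sup>2) + 2 * a * d * (- t s / 2)) = 1/2"
      using p[of s] unfolding weq[symmetric] xyz by (simp add: field_simps)
    then show "post_state (\<lambda>b. pauli (1/2) 0 0 (- t b / 2)) M i s
      = pauli (1/2) ((x + t s * B1) / (w - t s * z) / 2) ((y + t s * B2) / (w - t s * z) / 2)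
              ((z + t s * B3) / (w - t s * z) / 2)"
      unfolding post_state_def outcome_prob_diag[where t = t and M = M and i = i, OF M] unfolding M S pauli_sandwich scaleR_pauli pauli_eq_iff
      by (simp add: B xyz D_def power2_eq_square field_simps)
  qed
  \<comment> \<open>The terms in \<open>t\<close> cancel in the quotient rule, so the direction of
    the velocity is constant.\<close>
  define V1 V2 V3 where V: "V1 = w * B1 + z * x" "V2 = w * B2 + z * y" "V3 = w * B3 + z * z"
  have quot: "((\<lambda>s. (A + t s * B) / (w - t s * z)) has_real_derivative t' * (w * B + z * A) / (w - t \<beta> * z)\<^sup>2) (at \<beta>)"
    for A B
    using p[of \<beta>]
    by (auto intro!: derivative_eq_intros t simp: power2_eq_square field_simps)
  define u where "u = t \<beta>"
  have u: "u\<^sup>2 < 1" using lt[of \<beta>] by (simp add: u_def abs_square_less_1)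
  have P: "0 < w - u * z" using p[of \<beta>] by (simp add: u_def)
  have AV: "x * V1 + y * V2 + z * V3 = - z * D\<^sup>2"
    unfolding V B D_def weq xyz by algebra
  have BV: "B1 * V1 + B2 * V2 + B3 * V3 = w * D\<^sup>2"
    unfolding V B D_def weq xyz by algebra
  have BB: "B1\<^sup>2 + B2\<^sup>2 + B3\<^sup>2 = D\<^sup>2 + z\<^sup>2"
    unfolding V B D_def weq xyz by algebra
  have AB: "x * B1 + y * B2 + z * B3 = - z * w"
    unfolding V B D_def weq xyz by algebra
  have UV: "(x + u * B1) * V1 + (y + u * B2) * V2 + (z + u * B3) * V3 = D\<^sup>2 * (u * w - z)"
    using AV BV by algebra
  have VV: "V1\<^sup>2 + V2\<^sup>2 + V3\<^sup>2 = D\<^sup>2 * (w\<^sup>2 - z\<^sup>2)"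
    using AV BV V by algebra
  have UU: "(x + u * B1)\<^sup>2 + (y + u * B2)\<^sup>2 + (z + u * B3)\<^sup>2 = (w - u * z)\<^sup>2 - D\<^sup>2 * (1 - u\<^sup>2)"
    using AB BB D2 by algebra
  let ?P = "w - u * z"
  \<comment> \<open>The quotient of \<open>rr'\<close> by one minus \<open>rr\<close>, with the
    square of \<open>D\<close> cancelled. In this form it stays correct for \<open>D = 0\<close>,
    where the conditional state is pure.\<close>
  let ?k = "t' * (u * w - z) / (?P * (1 - u\<^sup>2))"
  have rr: "((x + u * B1) / ?P)\<^sup>2 + ((y + u * B2) / ?P)\<^sup>2 + ((z + u * B3) / ?P)\<^sup>2
      = 1 - D\<^sup>2 * (1 - u\<^sup>2) / ?P\<^sup>2"
    using P UU by (simp add: power_divide diff_divide_distrib flip: add_divide_distrib)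
  have rr': "(x + u * B1) / ?P * (t' * V1 / ?P\<^sup>2) + (y + u * B2) / ?P * (t' * V2 / ?P\<^sup>2)
      + (z + u * B3) / ?P * (t' * V3 / ?P\<^sup>2) = t' * (D\<^sup>2 * (u * w - z)) / (?P * ?P\<^sup>2)"
    unfolding UV[symmetric] by (simp add: add_divide_distrib algebra_simps)
  have r'r': "(t' * V1 / ?P\<^sup>2)\<^sup>2 + (t' * V2 / ?P\<^sup>2)\<^sup>2 + (t' * V3 / ?P\<^sup>2)\<^sup>2
      = t'\<^sup>2 * (D\<^sup>2 * (w\<^sup>2 - z\<^sup>2)) / (?P\<^sup>2)\<^sup>2"
    unfolding VV[symmetric]
    by (simp add: power_divide power_mult_distrib add_divide_distrib distrib_left)
  have cancel: "?k * (D\<^sup>2 * (1 - u\<^sup>2) / ?P\<^sup>2) = t' * (D\<^sup>2 * (u * w - z)) / (?P * ?P\<^sup>2)"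
    using u by simp
  have common_denominator: "s\<^sup>2 * (E * W) / (p\<^sup>2)\<^sup>2 + s * n / (p * q) * (s * (E * n) / (p * p\<^sup>2))
      = s\<^sup>2 * E * (W * q + n\<^sup>2) / ((p\<^sup>2)\<^sup>2 * q)" if "p \<noteq> 0" "q \<noteq> 0" for s E W n p q :: real
    using that by (simp add: field_simps power2_eq_square)
  have "quantum_fisher_info (post_state (\<lambda>b. pauli (1/2) 0 0 (- t b / 2)) M i) \<beta>
      = (t' * V1 / ?P\<^sup>2)\<^sup>2 + (t' * V2 / ?P\<^sup>2)\<^sup>2 + (t' * V3 / ?P\<^sup>2)\<^sup>2
        + ?k * ((x + u * B1) / ?P * (t' * V1 / ?P\<^sup>2) + (y + u * B2) / ?P * (t' * V2 / ?P\<^sup>2)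
              + (z + u * B3) / ?P * (t' * V3 / ?P\<^sup>2))"
    unfolding post V u_def
  proof (rule quantum_fisher_info_bloch; (rule quot)?)
    show "t' * (t \<beta> * w - z) / ((w - t \<beta> * z) * (1 - (t \<beta>)\<^sup>2))
       * (1 - (((x + t \<beta> * B1) / (w - t \<beta> * z))\<^sup>2 + ((y + t \<beta> * B2) / (w - t \<beta> * z))\<^sup>2
              + ((z + t \<beta> * B3) / (w - t \<beta> * z))\<^sup>2))
      = (x + t \<beta> * B1) / (w - t \<beta> * z) * (t' * (w * B1 + z * x) / (w - t \<beta> * z)\<^sup>2)
        + (y + t \<beta> * B2) / (w - t \<beta> * z) * (t' * (w * B2 + z * y) / (w - t \<beta> * z)\<^sup>2)
        + (z + t \<beta> * B3) / (w - t \<beta> * z) * (t' * (w * B3 + z * z) / (w - t \<beta> * z)\<^sup>2)"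
      unfolding u_def[symmetric] V[symmetric] rr rr' using cancel by simp
  qed
  also have "\<dots> = t'\<^sup>2 * D\<^sup>2 * ((w\<^sup>2 - z\<^sup>2) * (1 - u\<^sup>2) + (u * w - z)\<^sup>2) / ((?P\<^sup>2)\<^sup>2 * (1 - u\<^sup>2))"
    unfolding rr' r'r' using P u by - (rule common_denominator; simp)
  \<comment> \<open>This square removes two of the four powers of the outcome probability from the
    denominator.\<close>
  also have "(w\<^sup>2 - z\<^sup>2) * (1 - u\<^sup>2) + (u * w - z)\<^sup>2 = ?P\<^sup>2" by algebra
  also have "t'\<^sup>2 * D\<^sup>2 * ?P\<^sup>2 / ((?P\<^sup>2)\<^sup>2 * (1 - u\<^sup>2)) = D\<^sup>2 / ?P\<^sup>2 * (t'\<^sup>2 / (1 - u\<^sup>2))"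
    using P u by (simp add: divide_simps)
  finally show ?thesis by (simp add: D2 u_def)
qed

lemma fisher_info_binary:
  "fisher_info \<rho> M \<beta> = outcome_prob \<rho> M 0 \<beta> * (deriv (\<lambda>b. ln (outcome_prob \<rho> M 0 b)) \<beta>)\<^sup>2
     + outcome_prob \<rho> M 1 \<beta> * (deriv (\<lambda>b. ln (outcome_prob \<rho> M 1 b)) \<beta>)\<^sup>2"
  by (simp add: fisher_info_def)

lemma fisher_info_diag:
  assumes t: "(t has_real_derivative t') (at \<beta>)"
    and M: "M 0 = pauli w x y z" "M 1 = pauli (1 - w) (- x) (- y) (- z)"
    and p: "0 < w - t \<beta> * z" "w - t \<beta> * z < 1"
  shows "fisher_info (\<lambda>b. pauli (1/2) 0 0 (- t b / 2)) M \<beta>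
    = (t' * z)\<^sup>2 / ((w - t \<beta> * z) * (1 - (w - t \<beta> * z)))"
    (is "fisher_info ?\<rho> _ _ = _")
proof -
  have d: "deriv (\<lambda>b. ln (v - t b * s)) \<beta> = - (t' * s) / (v - t \<beta> * s)" if "0 < v - t \<beta> * s" for v s
    using that by (intro DERIV_imp_deriv) (auto intro!: derivative_eq_intros t)
  define P where "P = w - t \<beta> * z"
  have P: "0 < P" "P < 1" using p by (simp_all add: P_def)
  have P1: "1 - w - t \<beta> * (- z) = 1 - P" by (simp add: P_def)
  have op: "outcome_prob ?\<rho> M 0 b = w - t b * z" "outcome_prob ?\<rho> M 1 b = 1 - w - t b * (- z)" for b
    by (rule outcome_prob_diag M)+
  have d0: "deriv (\<lambda>b. ln (w - t b * z)) \<beta> = - (t' * z) / P"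
    using d[of w z] P unfolding P_def by blast
  have d1: "deriv (\<lambda>b. ln (1 - w - t b * (- z))) \<beta> = - (t' * (- z)) / (1 - P)"
    using d[of "1 - w" "- z"] P unfolding P1 by simp
  have "fisher_info ?\<rho> M \<beta> = P * (- (t' * z) / P)\<^sup>2 + (1 - P) * (- (t' * (- z)) / (1 - P))\<^sup>2"
    unfolding fisher_info_binary op d0 d1 P1 P_def[symmetric] ..
  also have "\<dots> = (t' * z)\<^sup>2 / (P * (1 - P))"
    using P by (simp add: divide_simps power2_eq_square) (simp add: algebra_simps)
  finally show ?thesis by (simp only: P_def)
qed

section \<open>The thermal qubit\<close>

lemma thermal_state_eq_pauli:
  "thermal_state \<delta> = (\<lambda>b. pauli (1/2) 0 0 (- tanh (b * \<delta> / 2) / 2))"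
proof
  fix b
  have "cosh (b * \<delta> / 2) - sinh (b * \<delta> / 2) = exp (- b * \<delta> / 2)"
    "cosh (b * \<delta> / 2) + sinh (b * \<delta> / 2) = exp (b * \<delta> / 2)"
    by (simp_all add: cosh_minus_sinh cosh_plus_sinh)
  note e = this[symmetric]
  show "thermal_state \<delta> b = pauli (1/2) 0 0 (- tanh (b * \<delta> / 2) / 2)"
    unfolding thermal_state_def e
    by (simp add: vec_eq_iff forall_2 pauli_nth vector_2 complex_eq_iff tanh_def field_simps)
qed

section \<open>The factor kappa\<close>

text \<open>The half-angle form has a visibly positive denominator and is easily solved for the
  square of \<open>c\<close>.\<close>

lemma kappa_eq:
  "kappa \<delta> \<beta> c = (1 - c\<^sup>2) / (1 + c\<^sup>2 * (sinh (\<beta> * \<delta> / 2))\<^sup>2)"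
proof -
  have "cosh (\<beta> * \<delta>) = cosh (\<beta> * \<delta> / 2 + \<beta> * \<delta> / 2)" by simp
  also have "\<dots> = 1 + 2 * (sinh (\<beta> * \<delta> / 2))\<^sup>2"
    unfolding cosh_add using cosh_square_eq[of "\<beta> * \<delta> / 2"] by (simp add: power2_eq_square)
  finally have "2 - c\<^sup>2 + c\<^sup>2 * cosh (\<beta> * \<delta>) = 2 * (1 + c\<^sup>2 * (sinh (\<beta> * \<delta> / 2))\<^sup>2)"
    by (simp add: algebra_simps)
  then show ?thesis unfolding kappa_def by (simp only: mult_divide_mult_cancel_left_if) simp
qed

text \<open>The form in which kappa arises as the ratio of Fisher information to
  disturbance.\<close>

lemma kappa_eq_tanh:
  assumes "t = tanh (\<beta> * \<delta> / 2)"
  shows "kappa \<delta> \<beta> c = (1 - c\<^sup>2) * (1 - t\<^sup>2) / (1 - t\<^sup>2 * (1 - c\<^sup>2))"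
proof -
  define C S where CS: "C = cosh (\<beta> * \<delta> / 2)" "S = sinh (\<beta> * \<delta> / 2)"
  have C: "0 < C" "C\<^sup>2 = S\<^sup>2 + 1" by (simp_all add: CS cosh_square_eq)
  have t: "t\<^sup>2 = S\<^sup>2 / C\<^sup>2" by (simp add: assms CS tanh_def power_divide)
  have "1 - t\<^sup>2 = 1 / C\<^sup>2" "1 - t\<^sup>2 * (1 - c\<^sup>2) = (1 + c\<^sup>2 * S\<^sup>2) / C\<^sup>2"
    using C(1) by (simp_all add: t field_simps) (simp_all add: C(2) algebra_simps)
  then show ?thesis using C(1) unfolding kappa_eq CS(2)[symmetric] by simp
qed

lemma kappa_bounds:
  assumes "c \<in> {0..1}"
  shows "kappa \<delta> \<beta> c \<in> {0..1}"
proof -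
  have "c\<^sup>2 \<le> 1" using assms by (simp add: abs_square_le_1)
  moreover have "0 \<le> c\<^sup>2 * (sinh (\<beta> * \<delta> / 2))\<^sup>2" by simp
  moreover have "1 - c\<^sup>2 \<le> 1" by simp
  ultimately have "0 \<le> 1 - c\<^sup>2" "0 < 1 + c\<^sup>2 * (sinh (\<beta> * \<delta> / 2))\<^sup>2"
    "1 - c\<^sup>2 \<le> 1 + c\<^sup>2 * (sinh (\<beta> * \<delta> / 2))\<^sup>2" by linarith+
  then show ?thesis unfolding kappa_eq by simp
qed

lemma kappa_surj:
  assumes "k \<in> {0..1}"
  obtains c where "c \<in> {0..1}" "kappa \<delta> \<beta> c = k"
proof -
  define S where "S = (sinh (\<beta> * \<delta> / 2))\<^sup>2"
  \<comment> \<open>The solution of \<open>kappa_eq\<close> with value \<open>k\<close>, which is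
    linear in the square of \<open>c\<close>.\<close>
  define c where "c = sqrt ((1 - k) / (1 + k * S))"
  have S: "0 \<le> S" by (simp add: S_def)
  then have kS: "0 \<le> k * S" using assms by simp
  have c2: "c\<^sup>2 = (1 - k) / (1 + k * S)" using assms kS by (simp add: c_def)
  have "c \<in> {0..1}" using assms kS by (simp add: c_def divide_simps)
  moreover have "kappa \<delta> \<beta> c = k"
  proof -
    have "c\<^sup>2 * (1 + k * S) = 1 - k" using c2 kS by simp
    then have "1 - c\<^sup>2 = k * (1 + c\<^sup>2 * S)" by (simp add: algebra_simps)
    moreover have "1 + c\<^sup>2 * S > 0" using S by (intro add_pos_nonneg) simp_all
    ultimately show ?thesis by (simp add: kappa_eq flip: S_def)
  qed
  ultimately show ?thesis by (rule that)
qed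

section \<open>The point given by one scheme\<close>

lemma square_mult_cos_less_1:
  fixes t \<theta> :: real
  assumes "\<bar>t\<bar> < 1"
  shows "(t * cos \<theta>)\<^sup>2 < 1"
proof -
  have "\<bar>t * cos \<theta>\<bar> \<le> \<bar>t\<bar>"
    using mult_left_mono[OF abs_cos_le_one[of \<theta>] abs_ge_zero[of t]] by (simp add: abs_mult)
  then show ?thesis using assms by (simp add: abs_square_less_1)
qed

text \<open>Here \<open>p\<close> is the probability of outcome 0, and \<open>1 - g\<close> is the
  fraction of \<open>Q\<close> that the conditional states retain on average. Nonnegativity of
  \<open>g\<close> is read off its product form, the upper bound off the nonnegative determinants of
  the effects.\<close>

lemma scheme_point:
  fixes \<delta> \<beta> :: real
  assumes cc: "conical_coords w r \<theta> \<phi>" and t: "t = tanh (\<beta> * \<delta> / 2)"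
    and p: "p = w - t * (r * w * cos \<theta>)"
    and g: "g = (r * w)\<^sup>2 * (1 - (t * cos \<theta>)\<^sup>2) / (p * (1 - p))"
  defines "M \<equiv> binary_povm (conical_effect w r \<theta> \<phi>)"
    and "Q \<equiv> quantum_fisher_info (thermal_state \<delta>) \<beta>"
  shows "fisher_info (thermal_state \<delta>) M \<beta> = g * kappa \<delta> \<beta> (sin \<theta>) * Q"
    and "delta_disturbance (thermal_state \<delta>) M \<beta> = g * Q"
    and "g \<in> {0..1}"
proof -
  define T where "T = (\<lambda>b. tanh (b * \<delta> / 2))"
  have th: "thermal_state \<delta> = (\<lambda>b. pauli (1/2) 0 0 (- T b / 2))"
    by (simp add: thermal_state_eq_pauli T_def)
  have Tt: "T \<beta> = t" by (simp add: T_def t)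
  have "(T has_real_derivative (1 - t\<^sup>2) * (\<delta> / 2)) (at \<beta>)"
    unfolding T_def t by (auto intro!: derivative_eq_intros)
  \<comment> \<open>The value of the derivative can be forgotten: the Fisher information and
    \<open>Q\<close> both carry it as the factor \<open>t'\<close> squared.\<close>
  then obtain t' where dT: "(T has_real_derivative t') (at \<beta>)" by blast
  have T1: "\<bar>T b\<bar> < 1" for b
    using tanh_real_bounds[of "b * \<delta> / 2"] by (auto simp: T_def)
  then have t1: "\<bar>t\<bar> < 1" and t2: "t\<^sup>2 < 1" using Tt by (metis, metis abs_square_less_1)
  define x y z where xyz: "x = r * w * sin \<theta> * cos \<phi>" "y = r * w * sin \<theta> * sin \<phi>"
    "z = r * w * cos \<theta>"
  have w: "0 < w" "w \<le> 1/2" "0 \<le> r" "r \<le> 1" using cc by (auto simp: conical_coords_def)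
  have "x\<^sup>2 + y\<^sup>2 + z\<^sup>2
      = (r * w)\<^sup>2 * ((sin \<theta>)\<^sup>2 * ((cos \<phi>)\<^sup>2 + (sin \<phi>)\<^sup>2) + (cos \<theta>)\<^sup>2)"
    unfolding xyz by algebra
  then have n: "x\<^sup>2 + y\<^sup>2 + z\<^sup>2 = (r * w)\<^sup>2"
    by (simp only: sin_cos_squared_add2 sin_cos_squared_add mult_1_right)
  have "r * w \<le> w" using w by (simp add: mult_left_le_one_le)
  then have le: "(r * w)\<^sup>2 \<le> w\<^sup>2" using w by (intro power_mono) auto
  have le': "w\<^sup>2 \<le> (1 - w)\<^sup>2" using w by (intro power_mono) auto
  have M: "M 0 = pauli w x y z" "M 1 = pauli (1 - w) (- x) (- y) (- z)"
    by (simp_all add: M_def binary_povm_def conical_effect_def pauli_def xyz scaleR_diff_left)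
  have "\<bar>t * z\<bar> < w"
  proof -
    have "\<bar>z\<bar> \<le> r * w * 1" unfolding xyz abs_mult using w by (intro mult_mono) auto
    then have "\<bar>t * z\<bar> \<le> \<bar>t\<bar> * w"
      unfolding abs_mult using \<open>r * w \<le> w\<close> by (intro mult_left_mono) auto
    also have "\<dots> < w" using t1 w by simp
    finally show ?thesis .
  qed
  \<comment> \<open>The upper bound comes from \<open>p < 2 * w\<close> and
    \<open>w \<le> 1/2\<close>.\<close>
  then have p01: "0 < p" "p < 1" using w unfolding p xyz(3)[symmetric] by linarith+
  have p1: "1 - w - t * (- z) = 1 - p" by (simp add: p xyz)
  have pz: "w - t * z = p" by (simp add: p xyz)
  have Q: "Q = t'\<^sup>2 / (1 - t\<^sup>2)"
    using quantum_fisher_info_diag[OF dT] t2 by (simp add: Q_def th Tt)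
  have tc: "(t * cos \<theta>)\<^sup>2 < 1"
    using t1 by (rule square_mult_cos_less_1)
  have "fisher_info (thermal_state \<delta>) M \<beta> = (t' * z)\<^sup>2 / (p * (1 - p))"
    using fisher_info_diag[OF dT M] p01 by (simp add: th Tt pz)
  also have "\<dots> = g * kappa \<delta> \<beta> (sin \<theta>) * Q"
  proof -
    have "1 - (sin \<theta>)\<^sup>2 = (cos \<theta>)\<^sup>2" by (simp add: cos_squared_eq)
    \<comment> \<open>The denominator cancels against the numerator of \<open>g\<close>, and
      \<open>1 - t^2\<close> against the denominator of \<open>Q\<close>.\<close>
    then have "kappa \<delta> \<beta> (sin \<theta>) = (cos \<theta>)\<^sup>2 * (1 - t\<^sup>2) / (1 - (t * cos \<theta>)\<^sup>2)"
      by (simp add: kappa_eq_tanh[OF t] power_mult_distrib)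
    then show ?thesis using t2 tc by (simp add: g Q xyz power_mult_distrib)
  qed
  finally show "fisher_info (thermal_state \<delta>) M \<beta> = g * kappa \<delta> \<beta> (sin \<theta>) * Q" .
  \<comment> \<open>\<open>d\<close> and \<open>e\<close> are the determinants of the two
    effects.\<close>
  define d where "d = w\<^sup>2 - (r * w)\<^sup>2"
  define e where "e = (1 - w)\<^sup>2 - (r * w)\<^sup>2"
  have q0: "quantum_fisher_info (post_state (thermal_state \<delta>) M 0) \<beta> = d / p\<^sup>2 * Q"
    using quantum_fisher_info_post_state[where M = M and i = 0, OF dT T1 w(1) _ M(1)] n le
    by (simp add: th Tt Q pz d_def)
  have q1: "quantum_fisher_info (post_state (thermal_state \<delta>) M 1) \<beta> = e / (1 - p)\<^sup>2 * Q"
    using quantum_fisher_info_post_state[where M = M and i = 1, OF dT T1 _ _ M(2)] n w \<open>r * w \<le> w\<close>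
    unfolding th Tt Q p1 e_def by simp
  have g1: "g = 1 - d / p - e / (1 - p)"
  proof -
    \<comment> \<open>Both sides equal \<open>(r * w)^2 - (w - p)^2\<close>.\<close>
    have "(r * w)\<^sup>2 * (1 - (t * cos \<theta>)\<^sup>2) = p * (1 - p) - d * (1 - p) - e * p"
      unfolding d_def e_def p by algebra
    also have "\<dots> / (p * (1 - p)) = 1 - d / p - e / (1 - p)"
      using p01 by (simp add: diff_divide_distrib)
    finally show ?thesis by (simp add: g)
  qed
  have "outcome_prob (thermal_state \<delta>) M 0 \<beta> = p"
    unfolding th outcome_prob_diag[where t = T and M = M and i = 0, OF M(1)] Tt pz ..
  moreover have "outcome_prob (thermal_state \<delta>) M 1 \<beta> = 1 - p"
    unfolding th outcome_prob_diag[where t = T and M = M and i = 1, OF M(2)] Tt p1 ..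
  ultimately have "delta_disturbance (thermal_state \<delta>) M \<beta>
      = Q - (p * (d / p\<^sup>2 * Q) + (1 - p) * (e / (1 - p)\<^sup>2 * Q))"
    using q0 q1 by (simp add: delta_disturbance_def flip: Q_def)
  also have "\<dots> = g * Q"
  proof -
    have cancel: "s * (b / s\<^sup>2 * Q) = b / s * Q" if "s \<noteq> 0" for s b :: real
      using that by (simp add: power2_eq_square)
    have "p \<noteq> 0" "1 - p \<noteq> 0" using p01 by auto
    then show ?thesis unfolding g1 by (subst (1 2) cancel) (simp_all add: left_diff_distrib)
  qed
  finally show "delta_disturbance (thermal_state \<delta>) M \<beta> = g * Q" .
  have "0 \<le> g" unfolding g using p01 tc by (intro divide_nonneg_pos mult_nonneg_nonneg) auto
  moreover have "0 \<le> d / p" "0 \<le> e / (1 - p)"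
    using p01 le le' by (auto simp: d_def e_def intro!: divide_nonneg_pos)
  ultimately show "g \<in> {0..1}" unfolding g1 by simp
qed

section \<open>The regions traced out by families of schemes\<close>

text \<open>By \<open>scheme_point\<close> the angle fixes the direction and \<open>g\<close> the
  position along the segment, so it remains to realise every \<open>g\<close>. For
  \<open>g = 0\<close> this is the uninformative scheme \<open>r = 0\<close>, which has every
  noncommutativity.\<close>

lemma fixed_noncommutativity_region:
  fixes \<delta> \<beta> c :: real
  assumes c: "c \<in> {0..1}"
  defines "Q \<equiv> quantum_fisher_info (thermal_state \<delta>) \<beta>"
  shows "{(fisher_info (thermal_state \<delta>) M \<beta>, delta_disturbance (thermal_state \<delta>) M \<beta>) | M.
            has_noncommutativity M c}
       = closed_segment (0, 0) (kappa \<delta> \<beta> c * Q, Q)" (is "?L = ?R")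
proof -
  have R: "?R = {(g * kappa \<delta> \<beta> c * Q, g * Q) | g. g \<in> {0..1}}"
    by (auto simp: in_segment algebra_simps)
  have "(g * kappa \<delta> \<beta> c * Q, g * Q) \<in> ?L" if g: "g \<in> {0..1}" for g
  proof -
    define t where "t = tanh (\<beta> * \<delta> / 2)"
    define \<theta> where "\<theta> = arcsin c"
    have \<theta>: "sin \<theta> = c" "0 \<le> \<theta>" "\<theta> \<le> pi"
      using c arcsin_bounded[of c] arcsin_lbound[of c] arcsin_le_arcsin[of 0 c] by (auto simp: \<theta>_def)
    define q where "q = (t * cos \<theta>)\<^sup>2"
    have t1: "\<bar>t\<bar> < 1" using tanh_real_bounds[of "\<beta> * \<delta> / 2"] by (auto simp: t_def)
    have q: "0 \<le> q" "q < 1"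
      using square_mult_cos_less_1[OF t1] by (simp_all add: q_def)
    have gq: "0 \<le> g * q" using g q by simp
    \<comment> \<open>At \<open>w = 1/2\<close> the disturbance in units of \<open>Q\<close> is \<open>r\<^sup>2 (1 - q) / (1 - q r\<^sup>2)\<close>; solve for \<open>r\<close>.\<close>
    define r where "r = sqrt (g / (1 - q + g * q))"
    have r2: "r\<^sup>2 = g / (1 - q + g * q)" using g q gq by (simp add: r_def)
    \<comment> \<open>Equivalent to \<open>g \<le> 1 - q + g * q\<close>, that is, to
      \<open>r \<le> 1\<close>.\<close>
    have "g * (1 - q) \<le> 1 - q" using g q by (simp add: mult_left_le_one_le)
    then have r: "0 \<le> r" "r \<le> 1" using g q gq by (auto simp: r_def divide_simps algebra_simps)
    define M where "M = binary_povm (conical_effect (1/2) r \<theta> 0)"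
    have cc: "conical_coords (1/2) r \<theta> 0" using r \<theta> by (simp add: conical_coords_def)
    define p where "p = 1/2 - t * (r * (1/2) * cos \<theta>)"
    have pp: "p * (1 - p) = (1 - r\<^sup>2 * q) / 4"
      by (simp add: p_def q_def power2_eq_square field_simps)
    have "r\<^sup>2 * (1 - q) = g * (1 - r\<^sup>2 * q)"
      using q gq by (simp add: r2 field_simps)
    then have rg: "(r * (1/2))\<^sup>2 * (1 - q) = g * ((1 - r\<^sup>2 * q) / 4)"
      by (simp add: power_divide)
    have "r\<^sup>2 * q \<le> q"
      using r q by (intro mult_left_le_one_le) (simp_all add: abs_square_le_1)
    then have "r\<^sup>2 * q < 1" using q by linarith
    then have "g = (r * (1/2))\<^sup>2 * (1 - (t * cos \<theta>)\<^sup>2) / (p * (1 - p))"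
      unfolding q_def[symmetric] pp rg by simp
    from scheme_point[OF cc t_def p_def this]
    have "fisher_info (thermal_state \<delta>) M \<beta> = g * kappa \<delta> \<beta> c * Q"
      "delta_disturbance (thermal_state \<delta>) M \<beta> = g * Q" by (simp_all add: M_def Q_def \<theta>)
    moreover have "has_noncommutativity M c"
      using cc \<theta> by (auto simp: has_noncommutativity_def M_def)
    ultimately show ?thesis by force
  qed
  moreover have "(fisher_info (thermal_state \<delta>) M \<beta>, delta_disturbance (thermal_state \<delta>) M \<beta>) \<in> ?R"
    if "has_noncommutativity M c" for M
  proof -
    obtain w r \<theta> \<phi> where cc: "conical_coords w r \<theta> \<phi>"
      and M: "M = binary_povm (conical_effect w r \<theta> \<phi>)" "c = sin \<theta>"
      using \<open>has_noncommutativity M c\<close> by (auto simp: has_noncommutativity_def)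
    note scheme_point[where \<delta> = \<delta> and \<beta> = \<beta>, OF cc refl refl refl, folded M Q_def]
    then show ?thesis unfolding R by blast
  qed
  ultimately show ?thesis unfolding R by blast
qed

lemma binary_scheme_iff: "binary_scheme M \<longleftrightarrow> (\<exists>c\<in>{0..1}. has_noncommutativity M c)"
proof -
  have "sin \<theta> \<in> {0..1}" if "conical_coords w r \<theta> \<phi>" for w r \<theta> \<phi>
    using that by (auto simp: conical_coords_def intro: sin_ge_zero)
  then show ?thesis unfolding binary_scheme_def has_noncommutativity_def by blast
qed

text \<open>The triangle is swept out by segments from the vertex \<open>(0, 0)\<close> to the
  opposite side. The point with weights \<open>a\<close>, \<open>b\<close> on the other two vertices
  lies at parameter \<open>a + b\<close> on the segment with \<open>k = b / (a + b)\<close>.\<close>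

lemma triangle_eq_Union_segments:
  "convex hull {(0, 0), (0, Q), (Q, Q)} = (\<Union>k\<in>{0..1}. closed_segment (0, 0) (k * Q, Q))"
  for Q :: real
proof (intro equalityI subsetI)
  fix v assume "v \<in> convex hull {(0, 0), (0, Q), (Q, Q)}"
  then obtain a b where ab: "0 \<le> a" "0 \<le> b" "a + b \<le> 1" and v: "v = (b * Q, (a + b) * Q)"
    unfolding convex_hull_3_alt by (auto simp: algebra_simps)
  \<comment> \<open>For \<open>a + b = 0\<close> the quotient is 0 by convention, and
    \<open>v\<close> is the origin, which lies on that segment too.\<close>
  define k where "k = b / (a + b)"
  have "k \<in> {0..1}" using ab by (auto simp: k_def divide_simps)
  moreover have "(a + b) * k = b" using ab by (auto simp: k_def)
  then have "v \<in> closed_segment (0, 0) (k * Q, Q)"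
    unfolding in_segment using ab by (intro exI[of _ "a + b"]) (simp add: v flip: mult.assoc)
  ultimately show "v \<in> (\<Union>k\<in>{0..1}. closed_segment (0, 0) (k * Q, Q))" by blast
next
  fix v assume "v \<in> (\<Union>k\<in>{0..1}. closed_segment (0, 0) (k * Q, Q))"
  then obtain k g where k: "0 \<le> k" "k \<le> 1" "0 \<le> g" "g \<le> 1" and v: "v = (g * (k * Q), g * Q)"
    by (auto simp: in_segment)
  have "0 \<le> g * (1 - k)" "0 \<le> g * k" using k by simp_all
  moreover have "g * (1 - k) + g * k \<le> 1" using k by (simp add: algebra_simps)
  ultimately show "v \<in> convex hull {(0, 0), (0, Q), (Q, Q)}"
    unfolding convex_hull_3_alt mem_Collect_eq v
    by (intro exI[of _ "g * (1 - k)"] exI[of _ "g * k"]) (simp add: algebra_simps)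
qed

theorem proposition2:
  fixes \<delta> \<beta> :: real
  assumes "\<delta> > 0"
  shows "{(fisher_info (thermal_state \<delta>) M \<beta>, delta_disturbance (thermal_state \<delta>) M \<beta>) | M.
            binary_scheme M}
         = convex hull {(0, 0), (0, quantum_fisher_info (thermal_state \<delta>) \<beta>),
                        (quantum_fisher_info (thermal_state \<delta>) \<beta>, quantum_fisher_info (thermal_state \<delta>) \<beta>)}
       \<and> (\<forall>c\<in>{0..1}.
            {(fisher_info (thermal_state \<delta>) M \<beta>, delta_disturbance (thermal_state \<delta>) M \<beta>) | M.
               binary_scheme M \<and> has_noncommutativity M c}
            = closed_segment (0, 0)
                (kappa \<delta> \<beta> c * quantum_fisher_info (thermal_state \<delta>) \<beta>, quantum_fisher_info (thermal_state \<delta>) \<beta>))"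
proof (intro conjI ballI)
  let ?Q = "quantum_fisher_info (thermal_state \<delta>) \<beta>"
  let ?pt = "\<lambda>M. (fisher_info (thermal_state \<delta>) M \<beta>, delta_disturbance (thermal_state \<delta>) M \<beta>)"
  \<comment> \<open>Every scheme has some noncommutativity, so the region is a union of segments;
    these depend on \<open>c\<close> only through kappa, whose range is the whole unit
    interval.\<close>
  have "{?pt M | M. binary_scheme M} = (\<Union>c\<in>{0..1}. {?pt M | M. has_noncommutativity M c})"
    unfolding binary_scheme_iff by blast
  also have "\<dots> = (\<Union>c\<in>{0..1}. closed_segment (0, 0) (kappa \<delta> \<beta> c * ?Q, ?Q))"
    by (intro SUP_cong refl fixed_noncommutativity_region)
  also have "\<dots> = (\<Union>k\<in>kappa \<delta> \<beta> ` {0..1}. closed_segment (0, 0) (k * ?Q, ?Q))" by simp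
  also have "kappa \<delta> \<beta> ` {0..1} = {0..1}"
  proof (intro equalityI subsetI)
    show "k \<in> {0..1}" if "k \<in> kappa \<delta> \<beta> ` {0..1}" for k
      using that kappa_bounds by blast
    show "k \<in> kappa \<delta> \<beta> ` {0..1}" if "k \<in> {0..1}" for k
      using kappa_surj[OF that, of \<delta> \<beta>] by blast
  qed
  finally show "{?pt M | M. binary_scheme M} = convex hull {(0, 0), (0, ?Q), (?Q, ?Q)}"
    unfolding triangle_eq_Union_segments .
  fix c :: real assume c: "c \<in> {0..1}"
  then have "binary_scheme M \<and> has_noncommutativity M c \<longleftrightarrow> has_noncommutativity M c" for M
    unfolding binary_scheme_iff by blast
  then show "{?pt M | M. binary_scheme M \<and> has_noncommutativity M c}
      = closed_segment (0, 0) (kappa \<delta> \<beta> c * ?Q, ?Q)"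
    using fixed_noncommutativity_region[OF c] by simp
qed

end
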